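(* Let $G=(V,E,\vec{c})$ be a capacitated undirected tree, rooted at an arbitrary vertex, and let $\vec{d}_1,\dots,\vec{d}_k$ be supply vectors on $G$. For each $i$, let $v_i$ be the vertex produced by the following procedure. Start with $v_i$ equal to the lowest common ancestor of the sources of $\vec{d}_i$. While $v_i$ has a child $u$ with $\sum_{v\not\preceq u}|\vec{d}_i(v)|<\sum_{v\preceq u}|\vec{d}_i(v)|$, replace $v_i$ by such a child $u$. Then $(v_1,\dots,v_k)$ is an optimum solution of LoMuF on $(G;\vec{d}_1,\dots,\vec{d}_k)$, i.e. $\lambda(G;\vec{d}_1\circ v_1,\dots,\vec{d}_k\circ v_k)=\lambda(G;\vec{d}_1,\dots,\vec{d}_k)$.
   Context: In a rooted tree, $u\preceq v$ means that $u$ is $v$ or a descendant of $v$. A capacitated undirected graph is $G=(V,E,\vec{c})$ with capacities $\vec{c}\in\mathbb{R}_+^E$. Every edge is given an arbitrary fixed orientation. A demand vector is $\vec{d}\in\mathbb{R}^V$ with zero sum. A flow $\vec{f}\in\mathbb{R}^E$, where negative values mean transport against the orientation, satisfies $\vec{d}$ if for every $v$, $\vec{d}(v)$ equals the sum of $\vec{f}$ over edges oriented into $v$ minus the sum over edges oriented out of $v$. A family of flows is valid if for each edge $e$ the sum of $|\vec{f}_i(e)|$ is at most $\vec{c}(e)$. For demand vectors $\vec{d}_1,\dots,\vec{d}_k$, $\lambda(G;\vec{d}_1,\dots,\vec{d}_k)$ is the maximum $\lambda\ge 0$ such that some valid family $\vec{f}_1,\dots,\vec{f}_k$ has each $\vec{f}_i$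 satisfying $\lambda\vec{d}_i$. A supply vector is $\vec{d}\in\mathbb{R}_-^V$, and its sources are the $v$ with $\vec{d}(v)<0$. For $v\in V$, $\vec{d}\circ v$ is the demand vector equal to $\vec{d}(u)$ at $u\neq v$ and to $-\sum_{w\ne v}\vec{d}(w)$ at $v$. LoMuF asks for $v_1,\dots,v_k\in V$ maximizing $\lambda(G;\vec{d}_1\circ v_1,\dots,\vec{d}_k\circ v_k)$. Its optimum value is denoted $\lambda(G;\vec{d}_1,\dots,\vec{d}_k)$. *)

theory Defs
  imports "HOL-Analysis.Function_Topology" "HOL-Library.Extended_Real"
begin

section \<open>Capacitated undirected graphs and trees\<close>

text \<open>An edge is the two-element set of its endpoints; \<open>tail\<close> and \<open>head\<close> are the
  arbitrary fixed orientation, used only to give a meaning to the sign of a flow value.\<close>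

record 'v cap_graph =
  verts :: "'v set"
  edges :: "'v set set"
  tail :: "'v set \<Rightarrow> 'v"
  head :: "'v set \<Rightarrow> 'v"
  cap :: "'v set \<Rightarrow> real"

definition capacitated_graph :: "'v cap_graph \<Rightarrow> bool" where
  "capacitated_graph G \<longleftrightarrow>
     finite (verts G) \<and>
     (\<forall>e\<in>edges G. e \<subseteq> verts G \<and> card e = 2 \<and> e = {tail G e, head G e} \<and> 0 \<le> cap G e)"

definition is_path :: "'v cap_graph \<Rightarrow> 'v \<Rightarrow> 'v list \<Rightarrow> 'v \<Rightarrow> bool" where
  "is_path G u p v \<longleftrightarrow>
     p \<noteq> [] \<and> hd p = u \<and> last p = v \<and> set p \<subseteq> verts G \<and> distinct p \<and>
     successively (\<lambda>x y. {x, y} \<in> edges G) p"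

definition is_cycle :: "'v cap_graph \<Rightarrow> 'v list \<Rightarrow> bool" where
  "is_cycle G p \<longleftrightarrow> 3 \<le> length p \<and> is_path G (hd p) p (last p) \<and> {last p, hd p} \<in> edges G"

definition is_tree :: "'v cap_graph \<Rightarrow> bool" where
  "is_tree G \<longleftrightarrow>
     verts G \<noteq> {} \<and>
     (\<forall>u\<in>verts G. \<forall>v\<in>verts G. \<exists>p. is_path G u p v) \<and>
     \<not> (\<exists>p. is_cycle G p)"

text \<open>\<open>desc G r u v\<close> is \<open>u \<preceq> v\<close> in the tree \<open>G\<close> rooted at \<open>r\<close>: \<open>u\<close> is \<open>v\<close> or a
  descendant of \<open>v\<close>.\<close>

definition desc :: "'v cap_graph \<Rightarrow> 'v \<Rightarrow> 'v \<Rightarrow> 'v \<Rightarrow> bool" where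
  "desc G r u v \<longleftrightarrow> (\<exists>p. is_path G r p u \<and> v \<in> set p)"

definition is_child :: "'v cap_graph \<Rightarrow> 'v \<Rightarrow> 'v \<Rightarrow> 'v \<Rightarrow> bool" where
  "is_child G r u v \<longleftrightarrow> {u, v} \<in> edges G \<and> desc G r u v"

definition common_ancestor :: "'v cap_graph \<Rightarrow> 'v \<Rightarrow> 'v set \<Rightarrow> 'v \<Rightarrow> bool" where
  "common_ancestor G r S a \<longleftrightarrow> a \<in> verts G \<and> (\<forall>s\<in>S. desc G r s a)"

text \<open>For nonempty \<open>S\<close> the lowest common ancestor is unique; for \<open>S = {}\<close> every vertex is a
  common ancestor and the lowest ones are the vertices without children.\<close>

definition is_lca :: "'v cap_graph \<Rightarrow> 'v \<Rightarrow> 'v set \<Rightarrow> 'v \<Rightarrow> bool" where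
  "is_lca G r S a \<longleftrightarrow>
     common_ancestor G r S a \<and> (\<forall>b. common_ancestor G r S b \<and> desc G r b a \<longrightarrow> b = a)"


section \<open>Demands, flows and concurrent flow\<close>

definition supply_vector :: "'v cap_graph \<Rightarrow> ('v \<Rightarrow> real) \<Rightarrow> bool" where
  "supply_vector G d \<longleftrightarrow> (\<forall>v\<in>verts G. d v \<le> 0)"

definition sources :: "'v cap_graph \<Rightarrow> ('v \<Rightarrow> real) \<Rightarrow> 'v set" where
  "sources G d = {v \<in> verts G. d v < 0}"

definition demand_vector :: "'v cap_graph \<Rightarrow> ('v \<Rightarrow> real) \<Rightarrow> bool" where
  "demand_vector G d \<longleftrightarrow> (\<Sum>v\<in>verts G. d v) = 0"

definition flow_satisfies ::
    "'v cap_graph \<Rightarrow> ('v set \<Rightarrow> real) \<Rightarrow> ('v \<Rightarrow> real) \<Rightarrow> bool" where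
  "flow_satisfies G f d \<longleftrightarrow>
     (\<forall>v\<in>verts G. d v = (\<Sum>e | e \<in> edges G \<and> head G e = v. f e)
                      - (\<Sum>e | e \<in> edges G \<and> tail G e = v. f e))"

text \<open>Families \<open>x\<^sub>1, \<dots>, x\<^sub>k\<close> are indexed by \<open>i < k\<close>.\<close>

definition valid_family :: "'v cap_graph \<Rightarrow> nat \<Rightarrow> (nat \<Rightarrow> 'v set \<Rightarrow> real) \<Rightarrow> bool" where
  "valid_family G k f \<longleftrightarrow> (\<forall>e\<in>edges G. (\<Sum>i<k. \<bar>f i e\<bar>) \<le> cap G e)"

definition feasible_ratios :: "'v cap_graph \<Rightarrow> nat \<Rightarrow> (nat \<Rightarrow> 'v \<Rightarrow> real) \<Rightarrow> real set" where
  "feasible_ratios G k d =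
     {l. 0 \<le> l \<and> (\<exists>f. valid_family G k f \<and>
                       (\<forall>i<k. flow_satisfies G (f i) (\<lambda>v. l * d i v)))}"

text \<open>The supremum is a maximum whenever it is finite (lemma \<open>max_ratio_attained\<close>); it is
  \<open>\<infinity>\<close> when the feasible ratios are unbounded, e.g. when all demands vanish.\<close>

definition max_ratio :: "'v cap_graph \<Rightarrow> nat \<Rightarrow> (nat \<Rightarrow> 'v \<Rightarrow> real) \<Rightarrow> ereal" where
  "max_ratio G k d = (SUP l\<in>feasible_ratios G k d. ereal l)"


section \<open>LoMuF\<close>

definition with_sink :: "'v cap_graph \<Rightarrow> ('v \<Rightarrow> real) \<Rightarrow> 'v \<Rightarrow> 'v \<Rightarrow> real" where
  "with_sink G d v = (\<lambda>u. if u = v then - (\<Sum>w\<in>verts G - {v}. d w) else d u)"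

definition lomuf_objective ::
    "'v cap_graph \<Rightarrow> nat \<Rightarrow> (nat \<Rightarrow> 'v \<Rightarrow> real) \<Rightarrow> (nat \<Rightarrow> 'v) \<Rightarrow> ereal" where
  "lomuf_objective G k d v = max_ratio G k (\<lambda>i. with_sink G (d i) (v i))"

definition lomuf_value :: "'v cap_graph \<Rightarrow> nat \<Rightarrow> (nat \<Rightarrow> 'v \<Rightarrow> real) \<Rightarrow> ereal" where
  "lomuf_value G k d = (SUP v \<in> {..<k} \<rightarrow> verts G. lomuf_objective G k d v)"

definition lomuf_optimum ::
    "'v cap_graph \<Rightarrow> nat \<Rightarrow> (nat \<Rightarrow> 'v \<Rightarrow> real) \<Rightarrow> (nat \<Rightarrow> 'v) \<Rightarrow> bool" where
  "lomuf_optimum G k d v \<longleftrightarrow>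
     v \<in> {..<k} \<rightarrow> verts G \<and>
     (\<forall>w \<in> {..<k} \<rightarrow> verts G. lomuf_objective G k d w \<le> lomuf_objective G k d v)"


section \<open>The sink placement procedure\<close>

definition descend_step :: "'v cap_graph \<Rightarrow> 'v \<Rightarrow> ('v \<Rightarrow> real) \<Rightarrow> 'v \<Rightarrow> 'v \<Rightarrow> bool" where
  "descend_step G r d v u \<longleftrightarrow>
     is_child G r u v \<and>
     (\<Sum>x | x \<in> verts G \<and> \<not> desc G r x u. \<bar>d x\<bar>) < (\<Sum>x | x \<in> verts G \<and> desc G r x u. \<bar>d x\<bar>)"

text \<open>A relation, since the procedure does not say which eligible child is taken.\<close>

definition procedure_result :: "'v cap_graph \<Rightarrow> 'v \<Rightarrow> ('v \<Rightarrow> real) \<Rightarrow> 'v \<Rightarrow> bool" where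
  "procedure_result G r d v \<longleftrightarrow>
     (\<exists>a. is_lca G r (sources G d) a \<and> (descend_step G r d)\<^sup>*\<^sup>* a v) \<and>
     \<not> (\<exists>u. descend_step G r d v u)"


section \<open>Consistency of the definitions\<close>

lemma demand_vector_with_sink:
  assumes "capacitated_graph G" "v \<in> verts G"
  shows "demand_vector G (with_sink G d v)"
proof -
  have fin: "finite (verts G)" using assms(1) by (simp add: capacitated_graph_def)
  have "(\<Sum>u\<in>verts G. with_sink G d v u) =
      with_sink G d v v + (\<Sum>u\<in>verts G - {v}. with_sink G d v u)"
    using fin assms(2) by (rule sum.remove)
  also have "(\<Sum>u\<in>verts G - {v}. with_sink G d v u) = (\<Sum>u\<in>verts G - {v}. d u)"
    by (rule sum.cong) (auto simp: with_sink_def)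
  finally show ?thesis by (simp add: demand_vector_def with_sink_def)
qed

lemma max_ratio_attained:
  assumes G: "capacitated_graph G" and fin: "max_ratio G k d \<noteq> \<infinity>"
  shows "\<exists>l \<in> feasible_ratios G k d. max_ratio G k d = ereal l"
proof -
  let ?S = "feasible_ratios G k d"
  have finE: "finite (edges G)"
    using G by (auto simp: capacitated_graph_def intro: finite_subset[of _ "Pow (verts G)"])
  have zero: "0 \<in> ?S"
    using G by (auto simp: feasible_ratios_def valid_family_def flow_satisfies_def
        capacitated_graph_def intro!: exI[of _ "\<lambda>_ _. 0"])
  have up: "ereal l \<le> max_ratio G k d" if "l \<in> ?S" for l
    using that by (simp add: max_ratio_def SUP_upper)
  obtain B where B: "max_ratio G k d = ereal B"
    using fin up[OF zero] by (cases "max_ratio G k d") auto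
  have leB: "l \<le> B" if "l \<in> ?S" for l using up[OF that] B by simp
  define C where "C = PiE UNIV (\<lambda>(i, e). if i < k \<and> e \<in> edges G then {- cap G e..cap G e} else {0})"
  define T where "T = {0..B} \<times> C \<inter>
    {(l, g). (\<forall>e\<in>edges G. (\<Sum>i<k. \<bar>g (i, e)\<bar>) \<le> cap G e) \<and>
      (\<forall>i<k. \<forall>v\<in>verts G. l * d i v = (\<Sum>e | e \<in> edges G \<and> head G e = v. g (i, e))
                      - (\<Sum>e | e \<in> edges G \<and> tail G e = v. g (i, e)))}"
  have "compact C"
    unfolding C_def compactin_euclidean_iff[symmetric] euclidean_product_topology[symmetric]
      compactin_PiE
    by auto
  then have cK: "compact ({0..B} \<times> C)" by (intro compact_Times) auto
  have co: "continuous_on UNIV (\<lambda>x :: real \<times> (nat \<times> 'a set \<Rightarrow> real). snd x j)" for j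
    by (rule continuous_on_product_then_coordinatewise) (intro continuous_intros)
  have "closed {(l, g). (\<forall>e\<in>edges G. (\<Sum>i<k. \<bar>g (i, e)\<bar>) \<le> cap G e) \<and>
      (\<forall>i<k. \<forall>v\<in>verts G. l * d i v = (\<Sum>e | e \<in> edges G \<and> head G e = v. g (i, e))
                      - (\<Sum>e | e \<in> edges G \<and> tail G e = v. g (i, e)))}"
    unfolding case_prod_unfold Ball_def
    by (intro closed_Collect_conj closed_Collect_all closed_Collect_imp open_Collect_const
        closed_Collect_le closed_Collect_eq continuous_intros co)
  then have cT: "compact T" unfolding T_def using cK by (rule compact_Int_closed[rotated])
  have "?S = fst ` T"
  proof (intro equalityI subsetI)
    fix l assume l: "l \<in> ?S"
    then obtain f where f: "valid_family G k f"
      "\<forall>i<k. flow_satisfies G (f i) (\<lambda>v. l * d i v)" and l0: "0 \<le> l"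
      by (auto simp: feasible_ratios_def)
    define g where "g = (\<lambda>(i, e). if i < k \<and> e \<in> edges G then f i e else 0)"
    have bd: "\<bar>f i e\<bar> \<le> cap G e" if "i < k" "e \<in> edges G" for i e
    proof -
      have "\<bar>f i e\<bar> \<le> (\<Sum>i<k. \<bar>f i e\<bar>)" using that by (intro member_le_sum) auto
      also have "\<dots> \<le> cap G e" using f(1) that by (auto simp: valid_family_def)
      finally show ?thesis .
    qed
    have "g \<in> C" using bd by (force simp: C_def g_def abs_le_iff split: if_splits)
    moreover have "(\<Sum>i<k. \<bar>g (i, e)\<bar>) \<le> cap G e" if "e \<in> edges G" for e
      using f(1) that by (simp add: valid_family_def g_def)
    moreover have "l * d i v = (\<Sum>e | e \<in> edges G \<and> head G e = v. g (i, e))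
                      - (\<Sum>e | e \<in> edges G \<and> tail G e = v. g (i, e))"
      if "i < k" "v \<in> verts G" for i v
      using f(2) that by (simp add: flow_satisfies_def g_def)
    ultimately have "(l, g) \<in> T" using l0 leB[OF l] by (simp add: T_def)
    then show "l \<in> fst ` T" by force
  next
    fix l assume "l \<in> fst ` T"
    then obtain g where "(l, g) \<in> T" by auto
    then show "l \<in> ?S"
      by (auto simp: T_def feasible_ratios_def valid_family_def flow_satisfies_def
          intro!: exI[of _ "\<lambda>i e. g (i, e)"])
  qed
  then have "compact ?S" using compact_continuous_image[OF continuous_on_fst[OF continuous_on_id] cT]
    by simp
  then obtain m where m: "m \<in> ?S" "\<And>l. l \<in> ?S \<Longrightarrow> l \<le> m"
    using compact_attains_sup[of ?S] zero by blast
  have "max_ratio G k d = ereal m"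
    unfolding max_ratio_def using m by (intro antisym SUP_least SUP_upper) auto
  with m(1) show ?thesis by blast
qed

end

(* Deleting a tree edge splits the vertices into two sides, and the absolute value of a flow on that
   edge is the net demand of either side. For a demand with a single sink this is the total supply of
   the side without the sink. The vertex found by the procedure lies, for every edge, on a side with
   at least half of the total supply. Hence moving a sink one edge towards it, by rerouting the whole
   supply over that edge, increases the flow on no edge. *)
theory Submission
  imports Defs
begin

section \<open>Paths in rooted trees\<close>

lemma is_path_prefix:
  assumes "is_path G r (A @ v # B) u"
  shows "is_path G r (A @ [v]) v"
proof -
  have "hd (A @ [v]) = hd (A @ v # B)" by (cases A) auto
  then show ?thesis
    using assms by (auto simp: is_path_def successively_append_iff)
qed

lemma is_path_snoc:
  assumes "is_path G r p u" "{u, v} \<in> edges G" "v \<in> verts G" "v \<notin> set p"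
  shows "is_path G r (p @ [v]) v"
  using assms by (auto simp: is_path_def successively_append_iff)

lemma is_path_ConsD:
  assumes "is_path G a (a # b # p) u"
  shows "is_path G b (b # p) u" "{a, b} \<in> edges G" "a \<notin> set (b # p)"
  using assms by (auto simp: is_path_def)

lemma is_path_Cons:
  assumes "is_path G r p u"
  obtains q where "p = r # q"
  using assms by (cases p) (auto simp: is_path_def)

text \<open>Go from \<open>r\<close> along the first path up to its first vertex \<open>z\<close> on
  the second one, then back along the second. By the choice of \<open>z\<close> the segments
  \<open>A\<close> and \<open>C\<close> between \<open>r\<close> and \<open>z\<close> are disjoint,
  and \<open>x \<noteq> y\<close> keeps them from both being empty, so the closed walk has at least
  three vertices.\<close>

lemma cycle_from_forking_paths:
  assumes p: "is_path G r (r # x # p) u" and q: "is_path G r (r # y # q) u" and "x \<noteq> y"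
  shows "\<exists>c. is_cycle G c"
proof -
  have "u \<in> set (x # p)" "u \<in> set (y # q)"
    using p q last_in_set[of "x # p"] last_in_set[of "y # q"] by (simp_all add: is_path_def)
  then have "\<exists>z \<in> set (x # p). z \<in> set (y # q)" by blast
  then obtain A z B where A: "x # p = A @ z # B" "z \<in> set (y # q)" "\<forall>w\<in>set A. w \<notin> set (y # q)"
    by (rule split_list_first_propE)
  obtain C D where C: "y # q = C @ z # D" using split_list[OF A(2)] by blast
  let ?c = "r # A @ z # rev C"
  have sym: "(\<lambda>a b. {b, a} \<in> edges G) = (\<lambda>a b. {a, b} \<in> edges G)"
    by (simp add: insert_commute)
  have P: "is_path G r (r # A @ z # B) u" and Q: "is_path G r (r # C @ z # D) u"
    using p q A(1) C by simp_all
  have disj: "set A \<inter> set C = {}" using A(3) C by auto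
  have sP: "successively (\<lambda>x y. {x, y} \<in> edges G) (r # A @ [z])"
    using P by (auto simp: is_path_def successively_append_iff successively_Cons hd_append)
  have "successively (\<lambda>x y. {x, y} \<in> edges G) (C @ [z])"
    using Q by (auto simp: is_path_def successively_append_iff successively_Cons)
  then have "successively (\<lambda>x y. {x, y} \<in> edges G) (rev (C @ [z]))"
    by (simp only: successively_rev sym)
  then have sC: "successively (\<lambda>x y. {x, y} \<in> edges G) (z # rev C)" by simp
  have "successively (\<lambda>x y. {x, y} \<in> edges G) ((r # A) @ z # rev C)"
    using sP sC successively_append_iff[of _ "r # A" "z # rev C"]
      successively_append_iff[of _ "r # A" "[z]"] by auto
  moreover have "distinct ?c" "set ?c \<subseteq> verts G"
    using P Q disj by (auto simp: is_path_def)
  ultimately have "is_path G (hd ?c) ?c (last ?c)" by (simp add: is_path_def)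
  moreover have "last ?c = y" using C by (cases C) auto
  moreover have "{y, r} \<in> edges G" using q by (simp add: is_path_def insert_commute)
  moreover have "A \<noteq> [] \<or> C \<noteq> []" using A(1) C \<open>x \<noteq> y\<close> by auto
  then have "3 \<le> length ?c" by (cases A; cases C) auto
  ultimately show ?thesis unfolding is_cycle_def by (intro exI[of _ ?c]) (simp add: insert_commute)
qed

text \<open>Induction along the paths: if they parted after the first vertex, they would fork and
  meet again at \<open>u\<close>, giving a cycle.\<close>

lemma is_path_unique:
  assumes acyclic: "\<not> (\<exists>c. is_cycle G c)" and "is_path G r p u" "is_path G r q u"
  shows "p = q"
  using assms(2,3)
proof (induction p arbitrary: r q)
  case Nil
  then show ?case by (simp add: is_path_def)
next
  case (Cons a p)
  have a: "a = r" using Cons.prems(1) by (simp add: is_path_def)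
  obtain q' where q: "q = r # q'" using Cons.prems(2) by (rule is_path_Cons)
  show ?case
  proof (cases "p = [] \<or> q' = []")
    \<comment> \<open>A one-vertex path forces \<open>u = r\<close>, and a repetition-free path
      whose two ends agree has only one vertex.\<close>
    case True
    then have "u = r" using Cons.prems a q by (auto simp: is_path_def)
    then show ?thesis using Cons.prems a q by (auto simp: is_path_def split: if_splits)
  next
    case False
    then obtain x p2 y q2 where p2: "p = x # p2" and q2: "q' = y # q2"
      by (auto simp: neq_Nil_conv)
    have "x = y"
      using cycle_from_forking_paths[of G r x p2 u y q2] Cons.prems acyclic a q p2 q2 by blast
    then show ?thesis
      using Cons.IH[of x q'] is_path_ConsD(1)[of G r x p2 u] is_path_ConsD(1)[of G r y q2 u]
        Cons.prems a q p2 q2 by simp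
  qed
qed

section \<open>The descendant order of a rooted tree\<close>

locale rooted_tree =
  fixes G :: "'v cap_graph" and r :: 'v
  assumes graph: "capacitated_graph G" and tree: "is_tree G" and root: "r \<in> verts G"
begin

lemma fin_verts: "finite (verts G)"
  using graph by (simp add: capacitated_graph_def)

lemma fin_edges: "finite (edges G)"
  using graph by (auto simp: capacitated_graph_def intro: finite_subset[of _ "Pow (verts G)"])

lemma edgeD:
  assumes "{a, b} \<in> edges G"
  shows "a \<in> verts G" "b \<in> verts G" "a \<noteq> b"
  using assms graph by (force simp: capacitated_graph_def)+

lemma orientation:
  assumes "e \<in> edges G"
  shows "e = {tail G e, head G e}"
  using assms graph by (simp add: capacitated_graph_def)

lemma path_unique: "is_path G r p u \<Longrightarrow> is_path G r q u \<Longrightarrow> p = q"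
  using is_path_unique[of G r p u q] tree by (simp add: is_tree_def)

lemma path_exists: "u \<in> verts G \<Longrightarrow> \<exists>p. is_path G r p u"
  using tree root unfolding is_tree_def by blast

text \<open>As root paths are unique, any one of them decides the existential in
  \<open>desc\<close>.\<close>

lemma desc_iff: "is_path G r p u \<Longrightarrow> desc G r u v \<longleftrightarrow> v \<in> set p"
  using path_unique unfolding desc_def by blast

lemma desc_verts: "desc G r u v \<Longrightarrow> u \<in> verts G \<and> v \<in> verts G"
  by (auto simp: desc_def is_path_def)

lemma desc_refl: "u \<in> verts G \<Longrightarrow> desc G r u u"
  using path_exists[of u] by (auto simp: desc_def is_path_def)

lemma desc_trans:
  assumes "desc G r u v" "desc G r v w"
  shows "desc G r u w"
proof -
  obtain p where p: "is_path G r p u" "v \<in> set p" using assms(1) by (auto simp: desc_def)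
  then obtain A B where AB: "p = A @ v # B" using split_list by metis
  have "is_path G r (A @ [v]) v" using p(1) unfolding AB by (rule is_path_prefix)
  then have "w \<in> set (A @ [v])" using assms(2) desc_iff by blast
  then show ?thesis using desc_iff[OF p(1)] AB by auto
qed

text \<open>Both ancestors lie on the root path of \<open>x\<close>, and its prefix up to the later
  one contains the earlier one. Hence two subtrees are nested or disjoint.\<close>

lemma desc_linear:
  assumes "desc G r x a" "desc G r x b"
  shows "desc G r a b \<or> desc G r b a"
proof -
  obtain p where p: "is_path G r p x" "a \<in> set p" using assms(1) by (auto simp: desc_def)
  have b: "b \<in> set p" using assms(2) desc_iff[OF p(1)] by blast
  obtain A B where AB: "p = A @ a # B" using p(2) split_list by metis
  have pa: "is_path G r (A @ [a]) a" using p(1) AB is_path_prefix by metis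
  show ?thesis
  proof (cases "b \<in> set (A @ [a])")
    case True
    then show ?thesis using desc_iff[OF pa] by blast
  next
    case False
    then obtain B1 B2 where "B = B1 @ b # B2" using b AB split_list[of b B] by auto
    then have "is_path G r ((A @ a # B1) @ b # B2) x" using p(1) AB by simp
    then have "is_path G r ((A @ a # B1) @ [b]) b" by (rule is_path_prefix)
    then show ?thesis using desc_iff by force
  qed
qed

section \<open>Tree edges and the boundary of a subtree\<close>

lemma path_through_neighbour:
  assumes "is_path G r p x" "{x, y} \<in> edges G" "y \<in> set p"
  shows "\<exists>A. p = A @ [y, x]"
proof -
  obtain A B where AB: "p = A @ y # B" using assms(3) split_list by metis
  have "x \<noteq> y" using edgeD assms(2) by blast
  then have "x \<notin> set (A @ [y])"
    using assms(1) AB by (auto simp: is_path_def split: if_splits dest: last_in_set)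
  moreover have "is_path G r (A @ [y]) y" using assms(1) AB is_path_prefix by metis
  \<comment> \<open>Stopping at \<open>y\<close> and stepping over to \<open>x\<close> gives another
    root path of \<open>x\<close>, which must be \<open>p\<close> itself. So a neighbour of
    \<open>x\<close> on its root path is its predecessor.\<close>
  ultimately have "is_path G r ((A @ [y]) @ [x]) x"
    using assms(2) edgeD(1) by (intro is_path_snoc) (auto simp: insert_commute)
  then show ?thesis using path_unique[OF assms(1)] by auto
qed

lemma edge_child:
  assumes "{a, b} \<in> edges G"
  shows "is_child G r a b \<or> is_child G r b a"
proof -
  obtain p where p: "is_path G r p a" using path_exists edgeD assms by blast
  show ?thesis
  proof (cases "b \<in> set p")
    case True
    then show ?thesis using p assms by (auto simp: is_child_def desc_def)
  next
    case False
    then have "is_path G r (p @ [b]) b" using p assms edgeD by (intro is_path_snoc)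
    moreover have "a \<in> set p" using p by (auto simp: is_path_def)
    ultimately show ?thesis using assms by (auto simp: is_child_def desc_def insert_commute)
  qed
qed

text \<open>The vertex \<open>y\<close> is on the root path of \<open>x\<close>, since otherwise
  extending that path would put \<open>y\<close> below \<open>c\<close>; so it is the predecessor of
  \<open>x\<close>. The path up to \<open>y\<close> misses \<open>c\<close>, which leaves
  \<open>x = c\<close>. The parent \<open>p\<close> is a predecessor of \<open>c\<close> as well,
  hence equals \<open>y\<close>.\<close>

lemma subtree_boundary:
  assumes c: "is_child G r c p" and e: "{x, y} \<in> edges G"
    and x: "desc G r x c" and y: "\<not> desc G r y c"
  shows "x = c \<and> y = p"
proof -
  obtain q where q: "is_path G r q x" "c \<in> set q" using x by (auto simp: desc_def)
  have "y \<in> set q"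
  proof (rule ccontr)
    assume "y \<notin> set q"
    then have "is_path G r (q @ [y]) y" using q(1) e edgeD by (intro is_path_snoc)
    then show False using q(2) y by (auto simp: desc_def)
  qed
  then obtain A where A: "q = A @ [y, x]" using path_through_neighbour q(1) e by blast
  have "is_path G r (A @ [y]) y" using q(1) A is_path_prefix[of G r A y "[x]"] by simp
  then have xc: "x = c" using desc_iff y q(2) A by auto
  have "p \<in> set q" using c desc_iff q(1) xc by (auto simp: is_child_def)
  then obtain A' where "q = A' @ [p, x]"
    using path_through_neighbour[OF q(1), of p] c xc by (auto simp: is_child_def)
  with A xc show ?thesis by auto
qed

text \<open>The child is the vertex right after \<open>v\<close> on the root path of
  \<open>c\<close>.\<close>

lemma child_towards:
  assumes "desc G r c v" "c \<noteq> v"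
  shows "\<exists>u. is_child G r u v \<and> desc G r c u"
proof -
  obtain p where p: "is_path G r p c" "v \<in> set p" using assms(1) by (auto simp: desc_def)
  obtain A B where AB: "p = A @ v # B" using p(2) split_list by metis
  have "B \<noteq> []" using p(1) AB assms(2) by (auto simp: is_path_def)
  then obtain u B' where B: "B = u # B'" by (cases B) auto
  have "is_path G r (A @ [v, u]) u" using p(1) AB B is_path_prefix[of G r "A @ [v]" u B'] by simp
  moreover from this have "{v, u} \<in> edges G"
    by (auto simp: is_path_def successively_append_iff)
  ultimately have "is_child G r u v" by (force simp: is_child_def desc_def insert_commute)
  moreover have "desc G r c u" using desc_iff[OF p(1)] AB B by auto
  ultimately show ?thesis by blast
qed

section \<open>Balance of the sink found by the procedure\<close>

definition subtree :: "'v \<Rightarrow> 'v set" where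
  "subtree c = {x \<in> verts G. desc G r x c}"

lemma sum_abs_mono: "A \<subseteq> B \<Longrightarrow> B \<subseteq> verts G \<Longrightarrow> (\<Sum>x\<in>A. \<bar>d x :: real\<bar>) \<le> (\<Sum>x\<in>B. \<bar>d x\<bar>)"
  using fin_verts by (intro sum_mono2) (auto intro: finite_subset)

lemma descend_step_iff:
  "descend_step G r d v u \<longleftrightarrow>
    is_child G r u v \<and> (\<Sum>x\<in>verts G - subtree u. \<bar>d x\<bar>) < (\<Sum>x\<in>subtree u. \<bar>d x\<bar>)"
proof -
  have "{x. x \<in> verts G \<and> \<not> desc G r x u} = verts G - subtree u" by (auto simp: subtree_def)
  then show ?thesis by (simp add: descend_step_def subtree_def)
qed

lemma procedure_result_verts:
  assumes "procedure_result G r d v"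
  shows "v \<in> verts G"
proof -
  obtain a where a: "a \<in> verts G" "(descend_step G r d)\<^sup>*\<^sup>* a v"
    using assms by (auto simp: procedure_result_def is_lca_def common_ancestor_def)
  from a(2,1) show ?thesis
    by (induction rule: rtranclp_induct) (auto simp: descend_step_iff is_child_def dest: desc_verts)
qed

text \<open>This is the loop invariant. Initially all sources lie below the common ancestor, so no
  supply is outside its subtree; afterwards it is the condition for descending.\<close>

lemma procedure_result_heavy:
  assumes d: "supply_vector G d" and "procedure_result G r d v"
  shows "(\<Sum>x\<in>verts G - subtree v. \<bar>d x\<bar>) \<le> (\<Sum>x\<in>subtree v. \<bar>d x\<bar>)"
proof -
  obtain a where a: "common_ancestor G r (sources G d) a" "(descend_step G r d)\<^sup>*\<^sup>* a v"
    using assms(2) by (auto simp: procedure_result_def is_lca_def)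
  have "d x = 0" if "x \<in> verts G - subtree a" for x
    using that a(1) d by (force simp: common_ancestor_def sources_def subtree_def supply_vector_def)
  then have base: "(\<Sum>x\<in>verts G - subtree a. \<bar>d x\<bar>) \<le> (\<Sum>x\<in>subtree a. \<bar>d x\<bar>)"
    by (simp add: sum_nonneg)
  from a(2) base show ?thesis
    by (induction rule: rtranclp_induct) (auto simp: descend_step_iff)
qed

text \<open>For every tree edge, the side of \<open>v\<close> carries at least half of the supply;
  \<open>c\<close> stands for the lower end of the edge. The cases are \<open>c\<close> above or
  equal to \<open>v\<close>, strictly below it, and incomparable to it.\<close>

lemma procedure_result_balanced:
  assumes d: "supply_vector G d" and v: "procedure_result G r d v" and c: "c \<in> verts G"
  shows "v \<in> subtree c \<Longrightarrow> (\<Sum>x\<in>verts G - subtree c. \<bar>d x\<bar>) \<le> (\<Sum>x\<in>subtree c. \<bar>d x\<bar>)"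
    and "v \<notin> subtree c \<Longrightarrow> (\<Sum>x\<in>subtree c. \<bar>d x\<bar>) \<le> (\<Sum>x\<in>verts G - subtree c. \<bar>d x\<bar>)"
proof -
  have V: "v \<in> verts G" using v by (rule procedure_result_verts)
  have heavy: "(\<Sum>x\<in>verts G - subtree v. \<bar>d x\<bar>) \<le> (\<Sum>x\<in>subtree v. \<bar>d x\<bar>)"
    using d v by (rule procedure_result_heavy)
  {
    assume "v \<in> subtree c"
    then have "subtree v \<subseteq> subtree c" by (auto simp: subtree_def intro: desc_trans)
    then have "(\<Sum>x\<in>subtree v. \<bar>d x\<bar>) \<le> (\<Sum>x\<in>subtree c. \<bar>d x\<bar>)"
      "(\<Sum>x\<in>verts G - subtree c. \<bar>d x\<bar>) \<le> (\<Sum>x\<in>verts G - subtree v. \<bar>d x\<bar>)"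
      by (auto intro!: sum_abs_mono simp: subtree_def)
    with heavy show "(\<Sum>x\<in>verts G - subtree c. \<bar>d x\<bar>) \<le> (\<Sum>x\<in>subtree c. \<bar>d x\<bar>)" by linarith
  next
    assume nv: "v \<notin> subtree c"
    show "(\<Sum>x\<in>subtree c. \<bar>d x\<bar>) \<le> (\<Sum>x\<in>verts G - subtree c. \<bar>d x\<bar>)"
    proof (cases "desc G r c v")
      case True
      have "c \<noteq> v" using nv V by (auto simp: subtree_def desc_refl)
      \<comment> \<open>The procedure stopped at \<open>v\<close>, so its child \<open>u\<close>
        towards \<open>c\<close> fails the descent test, and the subtree of \<open>c\<close> is
        contained in that of \<open>u\<close>.\<close>
      then obtain u where u: "is_child G r u v" "desc G r c u" using child_towards True by blast
      then have "(\<Sum>x\<in>subtree u. \<bar>d x\<bar>) \<le> (\<Sum>x\<in>verts G - subtree u. \<bar>d x\<bar>)"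
        using v by (auto simp: procedure_result_def descend_step_iff not_less)
      moreover have "subtree c \<subseteq> subtree u" using u(2) by (auto simp: subtree_def intro: desc_trans)
      then have "(\<Sum>x\<in>subtree c. \<bar>d x\<bar>) \<le> (\<Sum>x\<in>subtree u. \<bar>d x\<bar>)"
        "(\<Sum>x\<in>verts G - subtree u. \<bar>d x\<bar>) \<le> (\<Sum>x\<in>verts G - subtree c. \<bar>d x\<bar>)"
        by (auto intro!: sum_abs_mono simp: subtree_def)
      ultimately show ?thesis by linarith
    next
      case False
      then have "subtree c \<inter> subtree v = {}"
        using nv V by (auto simp: subtree_def dest: desc_linear)
      then have "(\<Sum>x\<in>subtree c. \<bar>d x\<bar>) \<le> (\<Sum>x\<in>verts G - subtree v. \<bar>d x\<bar>)"
        "(\<Sum>x\<in>subtree v. \<bar>d x\<bar>) \<le> (\<Sum>x\<in>verts G - subtree c. \<bar>d x\<bar>)"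
        by (auto intro!: sum_abs_mono simp: subtree_def)
      with heavy show ?thesis by linarith
    qed
  }
qed

text \<open>The set \<open>X\<close> is the side of \<open>b\<close> after deleting the edge: the
  subtree of \<open>b\<close> if \<open>b\<close> is the child, otherwise the complement of the
  subtree of \<open>a\<close>. With this cut, moving a sink from \<open>a\<close> to
  \<open>b\<close> needs no distinction between upward and downward moves.\<close>

lemma balanced_cut:
  assumes d: "supply_vector G d" and v: "procedure_result G r d v" and e: "{a, b} \<in> edges G"
  obtains X where "X \<subseteq> verts G" "a \<notin> X" "b \<in> X"
    "\<And>x y. {x, y} \<in> edges G \<Longrightarrow> x \<in> X \<Longrightarrow> y \<notin> X \<Longrightarrow> x = b \<and> y = a"
    "v \<in> X \<Longrightarrow> (\<Sum>x\<in>verts G - X. \<bar>d x\<bar>) \<le> (\<Sum>x\<in>X. \<bar>d x\<bar>)"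
proof -
  \<comment> \<open>A parent is not below its child: the root path of \<open>c\<close> ends in
    \<open>y, c\<close>, so dropping \<open>c\<close> leaves the root path of
    \<open>y\<close>.\<close>
  have not_desc: "\<not> desc G r y c" if "is_child G r c y" for c y
  proof
    assume yc: "desc G r y c"
    obtain p where p: "is_path G r p c" "y \<in> set p"
      using \<open>is_child G r c y\<close> by (auto simp: is_child_def desc_def)
    then obtain A where A: "p = A @ [y, c]"
      using \<open>is_child G r c y\<close> path_through_neighbour[of p c y] by (auto simp: is_child_def)
    then have "is_path G r (A @ [y]) y" using p(1) is_path_prefix[of G r A y "[c]"] by simp
    then have "c \<in> set (A @ [y])" using desc_iff yc by blast
    then show False using p(1) A by (auto simp: is_path_def)
  qed
  from edge_child[OF e] show thesis
  proof
    assume ch: "is_child G r b a"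
    show thesis
    proof (rule that[of "subtree b"])
      show "subtree b \<subseteq> verts G" by (auto simp: subtree_def)
      show "a \<notin> subtree b" using not_desc ch by (auto simp: subtree_def)
      show "b \<in> subtree b" using desc_refl edgeD e by (auto simp: subtree_def)
      show "x = b \<and> y = a" if "{x, y} \<in> edges G" "x \<in> subtree b" "y \<notin> subtree b" for x y
        using subtree_boundary[OF ch, of x y] that edgeD by (auto simp: subtree_def)
      show "(\<Sum>x\<in>verts G - subtree b. \<bar>d x\<bar>) \<le> (\<Sum>x\<in>subtree b. \<bar>d x\<bar>)" if "v \<in> subtree b"
        using procedure_result_balanced(1) d v e that edgeD by blast
    qed
  next
    assume ch: "is_child G r a b"
    show thesis
    proof (rule that[of "verts G - subtree a"])
      show "verts G - subtree a \<subseteq> verts G" by auto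
      show "a \<notin> verts G - subtree a" using desc_refl by (auto simp: subtree_def)
      show "b \<in> verts G - subtree a" using not_desc ch edgeD e by (auto simp: subtree_def)
      show "x = b \<and> y = a"
        if "{x, y} \<in> edges G" "x \<in> verts G - subtree a" "y \<notin> verts G - subtree a" for x y
        using subtree_boundary[OF ch, of y x] that edgeD
        by (auto simp: subtree_def insert_commute)
      have "verts G - (verts G - subtree a) = subtree a" by (auto simp: subtree_def)
      then show "(\<Sum>x\<in>verts G - (verts G - subtree a). \<bar>d x\<bar>) \<le> (\<Sum>x\<in>verts G - subtree a. \<bar>d x\<bar>)"
        if "v \<in> verts G - subtree a"
        using procedure_result_balanced(2) d v e that edgeD by auto
    qed
  qed
qed

section \<open>Moving a sink\<close>

text \<open>In this form, two choices of the sink visibly differ by the total supply at just two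
  vertices.\<close>

lemma with_sink_eq:
  assumes "a \<in> verts G"
  shows "with_sink G d a u = d u - (if u = a then \<Sum>x\<in>verts G. d x else 0)"
  using sum.remove[OF fin_verts assms, of d] by (simp add: with_sink_def)

text \<open>Add up the conservation equations over \<open>X\<close>. Edges inside \<open>X\<close>
  cancel, edges outside do not occur, and only the cut edge is left, counted positively if it is
  oriented into \<open>X\<close>.\<close>

lemma flow_across_cut:
  assumes f: "flow_satisfies G f D" and X: "X \<subseteq> verts G" "a \<notin> X" "b \<in> X"
    and e: "{a, b} \<in> edges G"
    and cut: "\<And>x y. {x, y} \<in> edges G \<Longrightarrow> x \<in> X \<Longrightarrow> y \<notin> X \<Longrightarrow> x = b \<and> y = a"
  shows "(\<Sum>x\<in>X. D x) = (if head G {a, b} = b then f {a, b} else - f {a, b})"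
proof -
  have finX: "finite X" using X(1) fin_verts by (rule finite_subset)
  \<comment> \<open>Exchanging the sums counts each edge once, according to its end
    \<open>h e\<close>; this is applied with \<open>h\<close> as head and as tail.\<close>
  have count: "(\<Sum>x\<in>X. \<Sum>e | e \<in> edges G \<and> h e = x. f e) = (\<Sum>e\<in>edges G. if h e \<in> X then f e else 0)"
    for h :: "'v set \<Rightarrow> 'v"
  proof -
    have "(\<Sum>x\<in>X. \<Sum>e | e \<in> edges G \<and> h e = x. f e) = (\<Sum>x\<in>X. \<Sum>e\<in>edges G. if h e = x then f e else 0)"
      using fin_edges by (simp add: sum.inter_filter)
    also have "\<dots> = (\<Sum>e\<in>edges G. \<Sum>x\<in>X. if h e = x then f e else 0)" by (rule sum.swap)
    finally show ?thesis using finX by simp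
  qed
  have "(\<Sum>x\<in>X. D x) = (\<Sum>x\<in>X. (\<Sum>e | e \<in> edges G \<and> head G e = x. f e)
      - (\<Sum>e | e \<in> edges G \<and> tail G e = x. f e))"
    using f X(1) by (intro sum.cong) (auto simp: flow_satisfies_def)
  also have "\<dots> = (\<Sum>e\<in>edges G. (if head G e \<in> X then f e else 0) - (if tail G e \<in> X then f e else 0))"
    by (simp add: sum_subtractf count)
  also have "\<dots> = (\<Sum>e'\<in>{{a, b}}. (if head G e' \<in> X then f e' else 0) - (if tail G e' \<in> X then f e' else 0))"
  proof (rule sum.mono_neutral_right)
    show "\<forall>e'\<in>edges G - {{a, b}}.
      (if head G e' \<in> X then f e' else 0) - (if tail G e' \<in> X then f e' else 0) = 0"
    proof
      fix e' assume e': "e' \<in> edges G - {{a, b}}"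
      have "head G e' \<in> X \<longleftrightarrow> tail G e' \<in> X"
        using cut[of "head G e'" "tail G e'"] cut[of "tail G e'" "head G e'"] orientation[of e'] e'
        by (auto simp: insert_commute)
      then show "(if head G e' \<in> X then f e' else 0) - (if tail G e' \<in> X then f e' else 0) = 0"
        by simp
    qed
  qed (use fin_edges e in auto)
  also have "\<dots> = (if head G {a, b} = b then f {a, b} else - f {a, b})"
    using orientation[OF e] X(2,3) by (auto simp: doubleton_eq_iff)
  finally show ?thesis .
qed

text \<open>An extra amount \<open>s\<close> is sent from \<open>a\<close> to \<open>b\<close>; the
  sign of the update translates this into the orientation of the edge.\<close>

lemma flow_satisfies_update:
  assumes f: "flow_satisfies G f D" and e: "{a, b} \<in> edges G"
  shows "flow_satisfies G (f({a, b} := f {a, b} + (if head G {a, b} = b then s else - s)))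
    (\<lambda>u. D u + (if u = b then s else 0) - (if u = a then s else 0))"
proof -
  have upd: "(\<Sum>e | e \<in> edges G \<and> h e = u. (f(e0 := f e0 + t)) e) =
      (\<Sum>e | e \<in> edges G \<and> h e = u. f e) + (if h e0 = u then t else 0)"
    if "e0 \<in> edges G" for h :: "'v set \<Rightarrow> 'v" and e0 t u
  proof -
    have "(\<Sum>e | e \<in> edges G \<and> h e = u. (f(e0 := f e0 + t)) e) =
        (\<Sum>e | e \<in> edges G \<and> h e = u. f e + (if e = e0 then t else 0))"
      by (rule sum.cong) auto
    also have "\<dots> = (\<Sum>e | e \<in> edges G \<and> h e = u. f e) + (if h e0 = u then t else 0)"
      using fin_edges that by (simp add: sum.distrib)
    finally show ?thesis .
  qed
  have "(head G {a, b} = b \<and> tail G {a, b} = a) \<or> (head G {a, b} = a \<and> tail G {a, b} = b)"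
    using orientation[OF e] by (auto simp: doubleton_eq_iff)
  then show ?thesis
    using f edgeD(3)[OF e] unfolding flow_satisfies_def upd[OF e] by auto
qed

text \<open>With \<open>S\<close> the supply on the side of \<open>b\<close> and \<open>T\<close>
  that on the side of \<open>a\<close>, the edge carries \<open>l * S\<close> towards the sink
  \<open>a\<close>. After the move it carries \<open>l * T\<close> towards \<open>b\<close>, and
  \<open>T \<le> S\<close> because \<open>v\<close> is on the side of \<open>b\<close>.\<close>

lemma move_sink_edge:
  assumes d: "supply_vector G d" and v: "procedure_result G r d v" and l: "0 \<le> l"
    and p: "is_path G a (a # b # p) v"
    and f: "flow_satisfies G f (\<lambda>u. l * with_sink G d a u)"
  shows "\<exists>g. flow_satisfies G g (\<lambda>u. l * with_sink G d b u) \<and> (\<forall>e. \<bar>g e\<bar> \<le> \<bar>f e\<bar>)"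
proof -
  have e: "{a, b} \<in> edges G" and pb: "is_path G b (b # p) v" and na: "a \<notin> set (b # p)"
    using is_path_ConsD[OF p] by auto
  note ab = edgeD[OF e]
  obtain X where X: "X \<subseteq> verts G" "a \<notin> X" "b \<in> X"
    and cut: "\<And>x y. {x, y} \<in> edges G \<Longrightarrow> x \<in> X \<Longrightarrow> y \<notin> X \<Longrightarrow> x = b \<and> y = a"
    and bal: "v \<in> X \<Longrightarrow> (\<Sum>x\<in>verts G - X. \<bar>d x\<bar>) \<le> (\<Sum>x\<in>X. \<bar>d x\<bar>)"
    using balanced_cut[OF d v e] by blast
  \<comment> \<open>The only way out of \<open>X\<close> leads to \<open>a\<close>, so a walk that
    starts in \<open>X\<close> and avoids \<open>a\<close> stays there. The rest of the path to
    \<open>v\<close> is such a walk.\<close>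
  have stay: "last q \<in> X"
    if "successively (\<lambda>x y. {x, y} \<in> edges G) q" "q \<noteq> []" "hd q \<in> X" "a \<notin> set q" for q
    using that
  proof (induction q rule: induct_list012)
    case (3 x y q)
    then have "y \<in> X" using cut[of x y] by (metis list.sel(1) list.set_intros successively.simps(3))
    with 3 show ?case by simp
  qed auto
  have vX: "v \<in> X" using stay[of "b # p"] pb na X(3) by (auto simp: is_path_def)
  define S where "S = (\<Sum>x\<in>X. \<bar>d x\<bar>)"
  define T where "T = (\<Sum>x\<in>verts G - X. \<bar>d x\<bar>)"
  have abs: "\<bar>d x\<bar> = - d x" if "x \<in> verts G" for x
    using d that by (simp add: supply_vector_def)
  have "(\<Sum>x\<in>X. \<bar>d x\<bar>) = (\<Sum>x\<in>X. - d x)" using X(1) abs by (intro sum.cong) auto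
  then have SX: "(\<Sum>x\<in>X. d x) = - S" by (simp add: S_def sum_negf)
  have "(\<Sum>x\<in>verts G. \<bar>d x\<bar>) = (\<Sum>x\<in>verts G. - d x)" using abs by (intro sum.cong) auto
  then have tot: "(\<Sum>x\<in>verts G. d x) = - (S + T)"
    using sum.subset_diff[OF X(1) fin_verts, of "\<lambda>x. \<bar>d x\<bar>"] by (simp add: S_def T_def sum_negf)
  have ST: "0 \<le> T" "T \<le> S" using bal vX by (auto simp: S_def T_def sum_nonneg)
  have "(\<Sum>x\<in>X. l * with_sink G d a x) = (\<Sum>x\<in>X. l * d x)"
    using X(2) by (intro sum.cong) (auto simp: with_sink_def)
  then have "(\<Sum>x\<in>X. l * with_sink G d a x) = - (l * S)"
    using SX by (simp add: sum_distrib_left[symmetric])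
  then have fe: "(if head G {a, b} = b then f {a, b} else - f {a, b}) = - (l * S)"
    using flow_across_cut[OF f X e cut] by simp
  \<comment> \<open>The sink absorbs \<open>l * (S + T)\<close>, the whole scaled supply; sending
    this amount from \<open>a\<close> on to \<open>b\<close> transfers the sink.\<close>
  define g where "g = f({a, b} := f {a, b}
    + (if head G {a, b} = b then l * (S + T) else - (l * (S + T))))"
  have "(\<lambda>u. l * with_sink G d a u + (if u = b then l * (S + T) else 0)
      - (if u = a then l * (S + T) else 0)) = (\<lambda>u. l * with_sink G d b u)"
    using ab by (auto simp: with_sink_eq tot algebra_simps)
  then have "flow_satisfies G g (\<lambda>u. l * with_sink G d b u)"
    using flow_satisfies_update[OF f e, of "l * (S + T)"] by (simp add: g_def)
  moreover have "\<bar>g e'\<bar> \<le> \<bar>f e'\<bar>" for e'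
  proof (cases "e' = {a, b}")
    case True
    \<comment> \<open>The net flow into \<open>X\<close> changes from \<open>- (l * S)\<close> to
      \<open>- (l * S) + l * (S + T) = l * T\<close>.\<close>
    have "\<bar>f e'\<bar> = l * S" "\<bar>g e'\<bar> = l * T"
      using fe l ST True by (auto simp: g_def algebra_simps abs_mult split: if_splits)
    then show ?thesis using mult_left_mono[OF ST(2) l] by simp
  qed (simp add: g_def)
  ultimately show ?thesis by blast
qed

text \<open>The sink is moved edge by edge along a path to \<open>v\<close>; the edgewise bounds
  chain together.\<close>

lemma move_sink:
  assumes d: "supply_vector G d" and v: "procedure_result G r d v" and l: "0 \<le> l"
    and a: "a \<in> verts G" and f: "flow_satisfies G f (\<lambda>u. l * with_sink G d a u)"
  shows "\<exists>g. flow_satisfies G g (\<lambda>u. l * with_sink G d v u) \<and> (\<forall>e. \<bar>g e\<bar> \<le> \<bar>f e\<bar>)"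
proof -
  obtain p where "is_path G a p v"
    using tree a procedure_result_verts[OF v] unfolding is_tree_def by blast
  then show ?thesis using f
  proof (induction p arbitrary: a f rule: induct_list012)
    case 1
    then show ?case by (simp add: is_path_def)
  next
    case (2 x)
    then show ?case by (auto simp: is_path_def)
  next
    case (3 x b q)
    have p: "is_path G a (a # b # q) v" using "3.prems"(1) by (auto simp: is_path_def)
    obtain g where g: "flow_satisfies G g (\<lambda>u. l * with_sink G d b u)" "\<forall>e. \<bar>g e\<bar> \<le> \<bar>f e\<bar>"
      using move_sink_edge[OF d v l p "3.prems"(2)] by blast
    obtain h where "flow_satisfies G h (\<lambda>u. l * with_sink G d v u)" "\<forall>e. \<bar>h e\<bar> \<le> \<bar>g e\<bar>"
      using "3.IH"(2)[OF is_path_ConsD(1)[OF p] g(1)] by blast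
    with g(2) show ?case by (meson order_trans)
  qed
qed

section \<open>Comparison of the feasible ratios and optimality\<close>

lemma feasible_ratios_subset:
  assumes d: "\<And>i. i < k \<Longrightarrow> supply_vector G (d i)"
    and v: "\<And>i. i < k \<Longrightarrow> procedure_result G r (d i) (v i)"
    and w: "w \<in> {..<k} \<rightarrow> verts G"
  shows "feasible_ratios G k (\<lambda>i. with_sink G (d i) (w i))
    \<subseteq> feasible_ratios G k (\<lambda>i. with_sink G (d i) (v i))"
proof
  fix l assume "l \<in> feasible_ratios G k (\<lambda>i. with_sink G (d i) (w i))"
  then obtain f where l: "0 \<le> l" and f: "valid_family G k f"
    "\<And>i. i < k \<Longrightarrow> flow_satisfies G (f i) (\<lambda>u. l * with_sink G (d i) (w i) u)"
    by (auto simp: feasible_ratios_def)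
  \<comment> \<open>Each commodity is rerouted on its own with the same ratio \<open>l\<close>. As
    no edge carries more of any commodity, the joint capacities remain respected.\<close>
  have "\<exists>g. flow_satisfies G g (\<lambda>u. l * with_sink G (d i) (v i) u) \<and> (\<forall>e. \<bar>g e\<bar> \<le> \<bar>f i e\<bar>)"
    if "i < k" for i
    using move_sink[OF d[OF that] v[OF that] l _ f(2)[OF that]] w that by blast
  then obtain g where g: "\<And>i. i < k \<Longrightarrow> flow_satisfies G (g i) (\<lambda>u. l * with_sink G (d i) (v i) u)"
    "\<And>i e. i < k \<Longrightarrow> \<bar>g i e\<bar> \<le> \<bar>f i e\<bar>"
    by metis
  have "(\<Sum>i<k. \<bar>g i e\<bar>) \<le> (\<Sum>i<k. \<bar>f i e\<bar>)" for e
    using g(2) by (intro sum_mono) auto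
  then have "valid_family G k g"
    using f(1) by (auto simp: valid_family_def intro: order_trans)
  then show "l \<in> feasible_ratios G k (\<lambda>i. with_sink G (d i) (v i))"
    using g(1) l by (auto simp: feasible_ratios_def)
qed

end

theorem theorem2:
  fixes G :: "'v cap_graph" and r :: 'v and k :: nat
    and d :: "nat \<Rightarrow> 'v \<Rightarrow> real" and v :: "nat \<Rightarrow> 'v"
  assumes "capacitated_graph G"
    and "is_tree G"
    and "r \<in> verts G"
    and "\<And>i. i < k \<Longrightarrow> supply_vector G (d i)"
    and "\<And>i. i < k \<Longrightarrow> procedure_result G r (d i) (v i)"
  shows "lomuf_optimum G k d v \<and>
    max_ratio G k (\<lambda>i. with_sink G (d i) (v i)) = lomuf_value G k d"
proof -
  interpret rooted_tree G r using assms(1-3) by unfold_locales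
  have v: "v \<in> {..<k} \<rightarrow> verts G" using assms(5) procedure_result_verts by auto
  \<comment> \<open>Inclusion of the sets of feasible ratios compares their suprema, also when these
    are infinite.\<close>
  have le: "lomuf_objective G k d w \<le> lomuf_objective G k d v" if "w \<in> {..<k} \<rightarrow> verts G" for w
    unfolding lomuf_objective_def max_ratio_def
    using feasible_ratios_subset[OF assms(4,5) that] by (intro SUP_subset_mono) auto
  have "lomuf_value G k d = lomuf_objective G k d v"
    unfolding lomuf_value_def using v le by (intro antisym SUP_least SUP_upper) auto
  then show ?thesis using v le by (simp add: lomuf_optimum_def lomuf_objective_def)
qed

end
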